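(* Let $A\in\mathbb{R}^{N\times N}$, $B\in\mathbb{R}^{N\times q}$, $x_0\in\mathbb{R}^N$, $T>0$, let $A=\sum_{m=1}^M A_m$ be a splitting, let $(p_\omega)_{\omega=1}^{2^M}$ be probabilities assigned to the subsets of $\{1,\dots,M\}$, and let $0=t_0<t_1<\dots<t_K=T$ be a temporal grid with maximal spacing $h$. Assume that (1) every $A_m$ is dissipative, i.e. $\langle x,A_mx\rangle\le 0$ for all $x\in\mathbb{R}^N$ and all $m\in\{1,\dots,M\}$, and (2) $\sum_{\omega=1}^{2^M}p_\omega=1$ and $\pi_m>0$ for all $m\in\{1,\dots,M\}$. Let $u\in L^2(0,T;\mathbb{R}^q)$ be deterministic (independent of $\boldsymbol\omega$), let $x(t)$ solve $\dot x(t)=Ax(t)+Bu(t)$, $x(0)=x_0$, and, for each $\boldsymbol\omega\in\Omega^K$, let $x_h(\boldsymbol\omega,t)$ solve $\dot x_h(\boldsymbol\omega,t)=\mathcal{A}_h(\boldsymbol\omega,t)x_h(\boldsymbol\omega,t)+Bu(t)$, $x_h(\boldsymbol\omega,0)=x_0$, with the same input $u$. Put $e_h(\boldsymbol\omega,t)=x_h(\boldsymbol\omega,t)-x(t)$. Then for all $t\in[0,T]$ $$\mathbb{E}[|e_h(t)|^2]\le h\,\mathrm{Var}[\mathcal{A}]\,\bigl(\|A\|t^2+2t\bigr)\bigl(|x_0|+|Bu|_{L^1(0,T;\mathbb{R}^N)}\bigr)^2 .$$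
   Context: $|\cdot|$ is the Euclidean norm and $\|\cdot\|$ the induced operator norm of matrices; $|u|_{L^p(0,T;\mathbb{R}^n)}$ is the usual $L^p$-norm built from the Euclidean norm. Randomized splitting. $S_1,\dots,S_{2^M}$ is an enumeration of all subsets of $\{1,\dots,M\}$ (including the empty set); $\Omega=\{1,\dots,2^M\}$. Subset $S_\omega$ is given probability $p_\omega\ge 0$. The probability that index $m$ is selected is $\pi_m=\sum_{\omega:\,m\in S_\omega}p_\omega$. The grid spacings are $h_k=t_k-t_{k-1}$ and $h=\max_k h_k$. For $\boldsymbol\omega=(\omega_1,\dots,\omega_K)\in\Omega^K$ define the piecewise constant matrix $$\mathcal{A}_h(\boldsymbol\omega,t)=\sum_{m\in S_{\omega_k}}\frac{A_m}{\pi_m},\qquad t\in[t_{k-1},t_k).$$ The indices $\omega_k$ are chosen independently, i.e. $\Omega^K$ carries the probabilities $p(\boldsymbol\omega)=p_{\omega_1}p_{\omega_2}\cdots p_{\omega_K}$, and $\mathbb{E}[X]=\sum_{\boldsymbol\omega\in\Omega^K}X(\boldsymbol\omega)p(\boldsymbol\omega)$ (the argument $\boldsymbol\omega$ is suppressed inside $\mathbb{E}$). Finally $$\mathrm{Var}[\mathcal{A}]=\sum_{\omega=1}^{2^M}\Bigl\|\sum_{m\in S_\omega}\frac{A_m}{\pi_m}-A\Bigr\|^2p_\omega .$$ *)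

theory Defs
  imports "HOL-Analysis.Analysis"
begin

definition dissipative :: "real^'n^'n \<Rightarrow> bool" where
  "dissipative A \<longleftrightarrow> (\<forall>x. x \<bullet> (A *v x) \<le> 0)"

definition op_norm :: "real^'n^'m \<Rightarrow> real" where
  "op_norm A = onorm ((*v) A)"

definition in_Lp :: "real \<Rightarrow> real \<Rightarrow> (real \<Rightarrow> 'a::euclidean_space) \<Rightarrow> bool" where
  "in_Lp p T u \<longleftrightarrow> u \<in> borel_measurable (lebesgue_on {0<..<T})
     \<and> integrable (lebesgue_on {0<..<T}) (\<lambda>s. norm (u s) powr p)"

definition Lp_norm :: "real \<Rightarrow> real \<Rightarrow> (real \<Rightarrow> 'a::euclidean_space) \<Rightarrow> real" where
  "Lp_norm p T u = (LINT s|lebesgue_on {0<..<T}. norm (u s) powr p) powr (1 / p)"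

text \<open>Absolute continuity in the epsilon-delta sense. The library notion of the same name
  concerns measures. A division consists of finitely many nonempty compact intervals with
  pairwise disjoint interiors, so \<open>Inf k\<close> and \<open>Sup k\<close> are the endpoints of \<open>k\<close>.\<close>

definition abs_continuous_on :: "real \<Rightarrow> real \<Rightarrow> (real \<Rightarrow> 'a::real_normed_vector) \<Rightarrow> bool" where
  "abs_continuous_on a b f \<longleftrightarrow>
     (\<forall>\<epsilon>>0. \<exists>\<delta>>0. \<forall>D S. D division_of S \<and> S \<subseteq> {a..b} \<and> (\<Sum>k\<in>D. Sup k - Inf k) < \<delta> \<longrightarrow>
        (\<Sum>k\<in>D. norm (f (Sup k) - f (Inf k))) < \<epsilon>)"

text \<open>The right-hand sides below are discontinuous in time, since the input is only square
  integrable and the randomized matrix jumps at the grid points. Solutions are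
  therefore meant in the sense of Caratheodory.\<close>

definition solves_ivp ::
  "real \<Rightarrow> (real \<Rightarrow> 'a::real_normed_vector \<Rightarrow> 'a) \<Rightarrow> 'a \<Rightarrow> (real \<Rightarrow> 'a) \<Rightarrow> bool" where
  "solves_ivp T f x0 x \<longleftrightarrow> abs_continuous_on 0 T x \<and> x 0 = x0 \<and>
     (AE s in lebesgue_on {0..T}. (x has_vector_derivative f s (x s)) (at s within {0..T}))"

definition is_grid :: "real \<Rightarrow> nat \<Rightarrow> (nat \<Rightarrow> real) \<Rightarrow> bool" where
  "is_grid T K \<tau> \<longleftrightarrow> \<tau> 0 = 0 \<and> \<tau> K = T \<and> (\<forall>k\<in>{1..K}. \<tau> (k - 1) < \<tau> k)"

definition max_spacing :: "nat \<Rightarrow> (nat \<Rightarrow> real) \<Rightarrow> real" where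
  "max_spacing K \<tau> = Max ((\<lambda>k. \<tau> k - \<tau> (k - 1)) ` {1..K})"

definition Omega :: "nat \<Rightarrow> nat set" where
  "Omega M = {1..2 ^ M}"

definition enumerates_subsets :: "nat \<Rightarrow> (nat \<Rightarrow> nat set) \<Rightarrow> bool" where
  "enumerates_subsets M S \<longleftrightarrow> bij_betw S (Omega M) (Pow {1..M})"

definition sel_prob :: "nat \<Rightarrow> (nat \<Rightarrow> nat set) \<Rightarrow> (nat \<Rightarrow> real) \<Rightarrow> nat \<Rightarrow> real" where
  "sel_prob M S p m = (\<Sum>\<omega>\<in>{\<omega>\<in>Omega M. m \<in> S \<omega>}. p \<omega>)"

definition sampled_matrix ::
  "nat \<Rightarrow> (nat \<Rightarrow> nat set) \<Rightarrow> (nat \<Rightarrow> real) \<Rightarrow> (nat \<Rightarrow> real^'n^'n) \<Rightarrow> nat \<Rightarrow> real^'n^'n" where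
  "sampled_matrix M S p Am \<omega> = (\<Sum>m\<in>S \<omega>. (1 / sel_prob M S p m) *\<^sub>R Am m)"

text \<open>At most one summand below is nonzero. Outside \<open>[\<tau> 0, \<tau> K)\<close>, and in particular at the
  final time, the matrix is zero; this does not affect solutions.\<close>

definition random_matrix ::
  "nat \<Rightarrow> (nat \<Rightarrow> nat set) \<Rightarrow> (nat \<Rightarrow> real) \<Rightarrow> (nat \<Rightarrow> real^'n^'n) \<Rightarrow> nat \<Rightarrow> (nat \<Rightarrow> real)
     \<Rightarrow> (nat \<Rightarrow> nat) \<Rightarrow> real \<Rightarrow> real^'n^'n" where
  "random_matrix M S p Am K \<tau> \<omega> t =
     (\<Sum>k=1..K. if t \<in> {\<tau> (k - 1)..<\<tau> k} then sampled_matrix M S p Am (\<omega> k) else 0)"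

definition Omega_paths :: "nat \<Rightarrow> nat \<Rightarrow> (nat \<Rightarrow> nat) set" where
  "Omega_paths M K = {1..K} \<rightarrow>\<^sub>E Omega M"

definition expect :: "nat \<Rightarrow> (nat \<Rightarrow> real) \<Rightarrow> nat \<Rightarrow> ((nat \<Rightarrow> nat) \<Rightarrow> real) \<Rightarrow> real" where
  "expect M p K X = (\<Sum>\<omega>\<in>Omega_paths M K. X \<omega> * (\<Prod>k=1..K. p (\<omega> k)))"

definition Var_matrix ::
  "nat \<Rightarrow> (nat \<Rightarrow> nat set) \<Rightarrow> (nat \<Rightarrow> real) \<Rightarrow> (nat \<Rightarrow> real^'n^'n) \<Rightarrow> real^'n^'n \<Rightarrow> real" where
  "Var_matrix M S p Am A = (\<Sum>\<omega>\<in>Omega M. (op_norm (sampled_matrix M S p Am \<omega> - A))\<^sup>2 * p \<omega>)"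

end

theory Submission
  imports Defs
begin

text \<open>
  The error \<open>e = x\<^sub>h - x\<close> satisfies \<open>e' = \<A>\<^sub>h e + (\<A>\<^sub>h - A) x\<close> and \<open>e 0 = 0\<close>. Since every sampled
  matrix is dissipative, \<open>(|e|\<^sup>2)' \<le> 2 \<langle>e, (\<A>\<^sub>h - A) x\<rangle>\<close>, and the task is to show that the
  expectation of the right-hand side is of order \<open>h\<close>.

  On the \<open>k\<close>-th cell \<open>\<A>\<^sub>h - A\<close> is a matrix \<open>D\<^sub>k\<close> that depends on the \<open>k\<close>-th index only and has mean
  zero (\<open>mean_deviation\<close>), while \<open>e\<close> at the left end \<open>a\<close> of the cell depends on the earlier indices
  only, because solutions are unique (\<open>err_independent\<close>). Hence \<open>\<langle>e a, D\<^sub>k x\<rangle>\<close> has expectation zero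
  (\<open>expect_grid_err_uncorrelated\<close>), and only \<open>\<langle>e t - e a, D\<^sub>k x\<rangle>\<close> remains.

  Let \<open>R = |x\<^sub>0| + |Bu|\<close> with the \<open>L\<^sup>1\<close>-norm of \<open>Bu\<close>. Dissipativity bounds \<open>x\<close> and \<open>x\<^sub>h\<close> by \<open>R\<close>, and it
  bounds \<open>|e t|\<close> by \<open>R\<close> times \<open>I t\<close>, the integral of \<open>\<parallel>\<A>\<^sub>h - A\<parallel>\<close> up to time \<open>t\<close> (\<open>err_growth\<close>). The
  second form \<open>e' = A e + (\<A>\<^sub>h - A) x\<^sub>h\<close> of the error equation, in which the random matrix
  multiplies a bounded function only, then gives
  \<open>|e t - e a| \<le> h R (\<parallel>A\<parallel> I t + \<parallel>D\<^sub>k\<parallel>)\<close> (\<open>err_increment\<close>). Since \<open>\<parallel>D\<^sub>j\<parallel> \<parallel>D\<^sub>k\<parallel>\<close> has expectation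
  at most \<open>Var\<close> for all \<open>j\<close> and \<open>k\<close>, the product \<open>\<parallel>D\<^sub>k\<parallel> I t\<close> has expectation at most \<open>t Var\<close>. Altogether
  the derivative of the mean square error is at most \<open>2 h Var R\<^sup>2 (1 + \<parallel>A\<parallel> t)\<close>
  (\<open>expect_energy_rate\<close>), and integration in time yields the factor \<open>\<parallel>A\<parallel> t\<^sup>2 + 2 t\<close>.

  Solutions are only absolutely continuous with a derivative almost everywhere, so the passage from
  derivatives to increments rests on the fundamental theorem of calculus for such functions
  (\<open>fundamental_theorem_of_calculus_abs_continuous\<close>).
\<close>

section \<open>Absolutely continuous functions\<close>

lemma division_endpoints:
  fixes D :: "real set set"
  assumes "D division_of S" "k \<in> D"
  shows "Sup k \<in> k" "Inf k \<in> k" "k = {Inf k..Sup k}" "Inf k \<le> Sup k"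
proof -
  obtain u v where k: "k = cbox u v" using assms by blast
  moreover have "k \<noteq> {}" using assms by blast
  ultimately have "u \<le> v" by simp
  then show "Sup k \<in> k" "Inf k \<in> k" "k = {Inf k..Sup k}" "Inf k \<le> Sup k"
    using k by auto
qed

text \<open>Covers composition with Lipschitz maps. The bound is asked for along \<open>f\<close> only, so that
  the square of the norm is admissible as soon as \<open>f\<close> is bounded.\<close>

lemma abs_continuous_on_dominated:
  assumes f: "abs_continuous_on a b f" and "0 \<le> C"
    and le: "\<And>s t. s \<in> {a..b} \<Longrightarrow> t \<in> {a..b} \<Longrightarrow> norm (g s - g t) \<le> C * norm (f s - f t)"
  shows "abs_continuous_on a b g"
  unfolding abs_continuous_on_def
proof safe
  fix \<epsilon> :: real assume "0 < \<epsilon>"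
  then have "0 < \<epsilon> / (C + 1)" using \<open>0 \<le> C\<close> by simp
  then obtain \<delta> where "0 < \<delta>" and \<delta>: "\<And>D S. D division_of S \<Longrightarrow> S \<subseteq> {a..b} \<Longrightarrow>
      (\<Sum>k\<in>D. Sup k - Inf k) < \<delta> \<Longrightarrow> (\<Sum>k\<in>D. norm (f (Sup k) - f (Inf k))) < \<epsilon> / (C + 1)"
    using f unfolding abs_continuous_on_def by meson
  have "(\<Sum>k\<in>D. norm (g (Sup k) - g (Inf k))) < \<epsilon>"
    if D: "D division_of S" and S: "S \<subseteq> {a..b}" and small: "(\<Sum>k\<in>D. Sup k - Inf k) < \<delta>" for D S
  proof -
    have "(\<Sum>k\<in>D. norm (g (Sup k) - g (Inf k))) \<le> (\<Sum>k\<in>D. C * norm (f (Sup k) - f (Inf k)))"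
    proof (intro sum_mono le)
      fix k assume "k \<in> D"
      then show "Sup k \<in> {a..b}" "Inf k \<in> {a..b}"
        using division_endpoints[OF D] division_ofD(2)[OF D] S by blast+
    qed
    also have "\<dots> \<le> (C + 1) * (\<Sum>k\<in>D. norm (f (Sup k) - f (Inf k)))"
      unfolding sum_distrib_left[symmetric] by (intro mult_right_mono) (auto simp: sum_nonneg)
    also have "\<dots> < \<epsilon>"
      using \<delta>[OF D S small] \<open>0 \<le> C\<close> by (simp add: field_simps)
    finally show ?thesis .
  qed
  with \<open>0 < \<delta>\<close> show "\<exists>\<delta>>0. \<forall>D S. D division_of S \<and> S \<subseteq> {a..b} \<and> (\<Sum>k\<in>D. Sup k - Inf k) < \<delta> \<longrightarrow>
      (\<Sum>k\<in>D. norm (g (Sup k) - g (Inf k))) < \<epsilon>"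
    by blast
qed

lemma abs_continuous_on_subinterval:
  assumes "abs_continuous_on a b f" "{c..d} \<subseteq> {a..b}"
  shows "abs_continuous_on c d f"
  using assms unfolding abs_continuous_on_def by (meson order_trans)

lemma abs_continuous_on_diff:
  assumes "abs_continuous_on a b f" "abs_continuous_on a b g"
  shows "abs_continuous_on a b (\<lambda>t. f t - g t)"
  unfolding abs_continuous_on_def
proof safe
  fix \<epsilon> :: real assume "0 < \<epsilon>"
  then have "0 < \<epsilon> / 2" by simp
  obtain \<delta>1 where "0 < \<delta>1" and \<delta>1: "\<And>D S. D division_of S \<Longrightarrow> S \<subseteq> {a..b} \<Longrightarrow>
      (\<Sum>k\<in>D. Sup k - Inf k) < \<delta>1 \<Longrightarrow> (\<Sum>k\<in>D. norm (f (Sup k) - f (Inf k))) < \<epsilon> / 2"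
    using assms(1) \<open>0 < \<epsilon> / 2\<close> unfolding abs_continuous_on_def by meson
  obtain \<delta>2 where "0 < \<delta>2" and \<delta>2: "\<And>D S. D division_of S \<Longrightarrow> S \<subseteq> {a..b} \<Longrightarrow>
      (\<Sum>k\<in>D. Sup k - Inf k) < \<delta>2 \<Longrightarrow> (\<Sum>k\<in>D. norm (g (Sup k) - g (Inf k))) < \<epsilon> / 2"
    using assms(2) \<open>0 < \<epsilon> / 2\<close> unfolding abs_continuous_on_def by meson
  have "(\<Sum>k\<in>D. norm ((f (Sup k) - g (Sup k)) - (f (Inf k) - g (Inf k)))) < \<epsilon>"
    if "D division_of S" "S \<subseteq> {a..b}" "(\<Sum>k\<in>D. Sup k - Inf k) < min \<delta>1 \<delta>2" for D S
  proof -
    have "(\<Sum>k\<in>D. norm ((f (Sup k) - g (Sup k)) - (f (Inf k) - g (Inf k))))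
        \<le> (\<Sum>k\<in>D. norm (f (Sup k) - f (Inf k)) + norm (g (Sup k) - g (Inf k)))"
      by (intro sum_mono order_trans[OF _ norm_triangle_ineq4]) (simp add: algebra_simps)
    also have "\<dots> < \<epsilon>"
      using \<delta>1[of D S] \<delta>2[of D S] that by (simp add: sum.distrib)
    finally show ?thesis .
  qed
  with \<open>0 < \<delta>1\<close> \<open>0 < \<delta>2\<close>
  show "\<exists>\<delta>>0. \<forall>D S. D division_of S \<and> S \<subseteq> {a..b} \<and> (\<Sum>k\<in>D. Sup k - Inf k) < \<delta> \<longrightarrow>
      (\<Sum>k\<in>D. norm ((f (Sup k) - g (Sup k)) - (f (Inf k) - g (Inf k)))) < \<epsilon>"
    by (intro exI[of _ "min \<delta>1 \<delta>2"]) auto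
qed

lemma has_vector_derivative_straddle:
  fixes f :: "real \<Rightarrow> 'a::real_normed_vector"
  assumes f: "(f has_vector_derivative f') (at x within {a..b})" and "0 < e"
  obtains d where "0 < d"
    "\<And>u v. \<lbrakk>x \<in> {u..v}; {u..v} \<subseteq> {a..b}; {u..v} \<subseteq> ball x d\<rbrakk>
       \<Longrightarrow> norm ((v - u) *\<^sub>R f' - (f v - f u)) \<le> e * (v - u)"
proof -
  obtain d where "0 < d" and d: "\<And>y. \<lbrakk>y \<in> {a..b}; norm (y - x) < d\<rbrakk>
      \<Longrightarrow> norm (f y - f x - (y - x) *\<^sub>R f') \<le> e * norm (y - x)"
    using f \<open>0 < e\<close> unfolding has_vector_derivative_def has_derivative_within_alt by meson
  show thesis
  proof (rule that[OF \<open>0 < d\<close>])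
    fix u v assume x: "x \<in> {u..v}" and sub: "{u..v} \<subseteq> {a..b}" and fine: "{u..v} \<subseteq> ball x d"
    have u: "u \<in> {u..v}" and v: "v \<in> {u..v}" using x by auto
    have "norm ((v - u) *\<^sub>R f' - (f v - f u))
        = norm ((f u - f x - (u - x) *\<^sub>R f') - (f v - f x - (v - x) *\<^sub>R f'))"
      by (simp add: algebra_simps)
    also have "\<dots> \<le> norm (f u - f x - (u - x) *\<^sub>R f') + norm (f v - f x - (v - x) *\<^sub>R f')"
      by (rule norm_triangle_ineq4)
    also have "\<dots> \<le> e * norm (u - x) + e * norm (v - x)"
      using u v sub fine by (intro add_mono d) (auto simp: dist_real_def subset_iff)
    also have "\<dots> = e * (v - u)"
      using x by (simp add: algebra_simps)
    finally show "norm ((v - u) *\<^sub>R f' - (f v - f u)) \<le> e * (v - u)" .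
  qed
qed

text \<open>The Henstock-Kurzweil integral makes this direct. At a tag outside \<open>N\<close> the gauge is taken from
  the derivative, so the Riemann sum over these tags follows the increments of \<open>f\<close>. At a tag in
  \<open>N\<close> the gauge keeps the interval inside an open set \<open>U\<close> around \<open>N\<close> of small measure. These
  intervals have small total length, so absolute continuity makes the increments of \<open>f\<close> over
  them negligible, whatever \<open>f\<close> does there.\<close>

theorem fundamental_theorem_of_calculus_abs_continuous:
  fixes f :: "real \<Rightarrow> 'a::banach"
  assumes "a \<le> b" and ac: "abs_continuous_on a b f" and "negligible N"
    and deriv: "\<And>x. x \<in> {a..b} - N \<Longrightarrow> (f has_vector_derivative f' x) (at x within {a..b})"
  shows "(f' has_integral (f b - f a)) {a..b}"
proof -
  define g where "g = (\<lambda>x. if x \<in> N then 0 else f' x)"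
  have "(g has_integral (f b - f a)) {a..b}"
    unfolding has_integral_real
  proof safe
    fix e :: real assume "0 < e"
    \<comment> \<open>Half of the error is for each kind of tag; adding \<open>1\<close> covers the case \<open>a = b\<close>.\<close>
    define e1 where "e1 = e / 2 / (b - a + 1)"
    have "0 < e1" using \<open>0 < e\<close> \<open>a \<le> b\<close> by (simp add: e1_def)
    have e1: "e1 * (b - a) < e / 2"
      using \<open>0 < e\<close> \<open>a \<le> b\<close> by (simp add: e1_def field_simps)
    obtain \<delta> where "0 < \<delta>" and \<delta>: "\<And>D S. D division_of S \<Longrightarrow> S \<subseteq> {a..b} \<Longrightarrow>
        (\<Sum>k\<in>D. Sup k - Inf k) < \<delta> \<Longrightarrow> (\<Sum>k\<in>D. norm (f (Sup k) - f (Inf k))) < e / 2"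
      using ac \<open>0 < e\<close> unfolding abs_continuous_on_def by (meson half_gt_zero)
    have "N \<in> sets lebesgue" using \<open>negligible N\<close> by (simp add: negligible_imp_sets)
    then obtain U where U: "open U" "N \<subseteq> U" "U - N \<in> lmeasurable" "emeasure lebesgue (U - N) < ennreal \<delta>"
      using sets_lebesgue_outer_open \<open>0 < \<delta>\<close> by meson
    have Um: "U \<in> lmeasurable" "measure lebesgue U < \<delta>"
    proof -
      have eq: "U = (U - N) \<union> N" using U by blast
      have "N \<in> lmeasurable" using \<open>negligible N\<close> by (simp add: negligible_imp_measurable)
      with U(3) eq show "U \<in> lmeasurable" by (metis fmeasurable.Un)
      have "measure lebesgue U = measure lebesgue (U - N)"
        using \<open>negligible N\<close> \<open>U \<in> lmeasurable\<close>
        by (simp add: measure_Diff_null_set negligible_iff_null_sets fmeasurableD)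
      also have "\<dots> < \<delta>"
        using U(3,4) by (simp add: emeasure_eq_measure2 ennreal_less_iff)
      finally show "measure lebesgue U < \<delta>" .
    qed
    have "\<exists>d>0. (x \<in> N \<longrightarrow> ball x d \<subseteq> U) \<and> (x \<in> {a..b} - N \<longrightarrow>
        (\<forall>u v. x \<in> {u..v} \<longrightarrow> {u..v} \<subseteq> {a..b} \<longrightarrow> {u..v} \<subseteq> ball x d
          \<longrightarrow> norm ((v - u) *\<^sub>R f' x - (f v - f u)) \<le> e1 * (v - u)))" for x
    proof (cases "x \<in> N")
      case True
      then show ?thesis using U(1,2) open_contains_ball by blast
    next
      case False
      show ?thesis
      proof (cases "x \<in> {a..b}")
        case True
        then show ?thesis
          using has_vector_derivative_straddle[OF deriv \<open>0 < e1\<close>, of x] False by (metis DiffI)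
      next
        case out: False
        then show ?thesis using False by (intro exI[of _ 1]) auto
      qed
    qed
    then obtain d where d0: "\<And>x. 0 < d x" and dN: "\<And>x. x \<in> N \<Longrightarrow> ball x (d x) \<subseteq> U"
      and d: "\<And>x u v. \<lbrakk>x \<in> {a..b} - N; x \<in> {u..v}; {u..v} \<subseteq> {a..b}; {u..v} \<subseteq> ball x (d x)\<rbrakk>
        \<Longrightarrow> norm ((v - u) *\<^sub>R f' x - (f v - f u)) \<le> e1 * (v - u)"
      by metis
    show "\<exists>\<gamma>. gauge \<gamma> \<and> (\<forall>\<D>. \<D> tagged_division_of {a..b} \<and> \<gamma> fine \<D> \<longrightarrow>
        norm ((\<Sum>(x, k)\<in>\<D>. measure lborel k *\<^sub>R g x) - (f b - f a)) < e)"
    proof (intro exI conjI allI impI)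
      show "gauge (\<lambda>x. ball x (d x))" using d0 by (simp add: gauge_ball_dependent)
      fix \<D> assume "\<D> tagged_division_of {a..b} \<and> (\<lambda>x. ball x (d x)) fine \<D>"
      then have p: "\<D> tagged_division_of {a..b}" and fine: "(\<lambda>x. ball x (d x)) fine \<D>" by auto
      have fin: "finite \<D>" using p by blast
      define P where "P = {q \<in> \<D>. fst q \<in> N}"
      have P: "P \<subseteq> \<D>" "finite P" using fin by (auto simp: P_def)
      have int: "K = {Inf K..Sup K} \<and> Inf K \<le> Sup K \<and> x \<in> K \<and> K \<subseteq> {a..b} \<and> K \<subseteq> ball x (d x)
          \<and> measure lborel K = Sup K - Inf K" if "(x, K) \<in> \<D>" for x K
      proof -
        have 1: "K \<in> snd ` \<D>" using that by force
        have 2: "x \<in> K" "K \<subseteq> {a..b}" "K \<subseteq> ball x (d x)" 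
          using p that fine by (auto simp: fine_def)
        note 3 = division_endpoints[OF division_of_tagged_division[OF p] 1]
        have "measure lborel K = Sup K - Inf K" using 3(4) by (subst 3(3)) simp
        with 2 3 show ?thesis by blast
      qed
      have good: "norm (\<Sum>(x, K)\<in>\<D> - P. measure lborel K *\<^sub>R g x - (f (Sup K) - f (Inf K))) \<le> e1 * (b - a)"
      proof -
        have "norm (\<Sum>(x, K)\<in>\<D> - P. measure lborel K *\<^sub>R g x - (f (Sup K) - f (Inf K)))
          \<le> (\<Sum>(x, K)\<in>\<D> - P. e1 * (Sup K - Inf K))"
        proof (rule sum_norm_le, safe)
          fix x K assume K: "(x, K) \<in> \<D>" "(x, K) \<notin> P"
          then have "x \<notin> N" by (simp add: P_def)
          then show "norm (measure lborel K *\<^sub>R g x - (f (Sup K) - f (Inf K))) \<le> e1 * (Sup K - Inf K)"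
            using int[OF K(1)] d[of x "Inf K" "Sup K"] by (auto simp: g_def)
        qed
        also have "\<dots> \<le> (\<Sum>(x, K)\<in>\<D>. e1 * (Sup K - Inf K))"
          using fin int \<open>0 < e1\<close> by (intro sum_mono2) force+
        also have "\<dots> = e1 * (b - a)"
          using additive_tagged_division_1[OF \<open>a \<le> b\<close> p, of "\<lambda>x. x"]
          by (simp add: split_def sum_distrib_left[symmetric])
        finally show ?thesis .
      qed
      have bad: "norm (\<Sum>(x, K)\<in>P. measure lborel K *\<^sub>R g x - (f (Sup K) - f (Inf K))) < e / 2"
      proof -
        have part: "P tagged_partial_division_of {a..b}"
          using p P tagged_partial_division_subset unfolding tagged_division_of_def by blast
        \<comment> \<open>Passing from tagged intervals to the set of intervals merges degenerate ones, which
          contribute nothing. The value at the empty set is fixed to \<open>0\<close> because \<open>Sup {}\<close> and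
          \<open>Inf {}\<close> are unspecified.\<close>
        define h where "h = (\<lambda>K. if K = {} then 0 else norm (f (Sup K) - f (Inf K)))"
        note div = partial_division_of_tagged_division[OF part]
        have snd_int: "K = {Inf K..Sup K} \<and> Inf K \<le> Sup K \<and> K \<subseteq> U \<and> K \<subseteq> {a..b} \<and> measure lebesgue K = Sup K - Inf K"
          if K: "K \<in> snd ` P" for K
        proof -
          obtain x where "(x, K) \<in> P" using K by auto
          then have "(x, K) \<in> \<D>" "x \<in> N" by (auto simp: P_def)
          then have "K = {Inf K..Sup K}" "Inf K \<le> Sup K" "K \<subseteq> U" "K \<subseteq> {a..b}"
            using int[of x K] dN[of x] by blast+
          moreover from this have "measure lebesgue K = Sup K - Inf K"
            by (metis measure_completion sets_lborel borel_closed closed_atLeastAtMost content_real)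
          ultimately show ?thesis by blast
        qed
        have "(\<Sum>K\<in>snd ` P. Sup K - Inf K) = (\<Sum>K\<in>snd ` P. measure lebesgue K)"
          using snd_int by (intro sum.cong) auto
        also have "\<dots> = measure lebesgue (\<Union>(snd ` P))"
          using content_division[OF div] by simp
        also have "\<dots> \<le> measure lebesgue U"
        proof (intro measure_mono_fmeasurable sets.finite_Union)
          show "\<Union>(snd ` P) \<subseteq> U" using snd_int by blast
          show "snd ` P \<subseteq> sets lebesgue"
            using snd_int by (metis subsetI fmeasurableD lmeasurable_interval(1))
        qed (use P Um(1) in auto)
        finally have small: "(\<Sum>K\<in>snd ` P. Sup K - Inf K) < \<delta>" using Um(2) by simp
        have "norm (\<Sum>(x, K)\<in>P. measure lborel K *\<^sub>R g x - (f (Sup K) - f (Inf K)))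
            = norm (\<Sum>(x, K)\<in>P. f (Sup K) - f (Inf K))"
          by (subst norm_minus_cancel[symmetric], unfold sum_negf[symmetric], intro arg_cong[where f = norm] sum.cong)
             (auto simp: P_def g_def)
        also have "\<dots> \<le> (\<Sum>(x, K)\<in>P. norm (f (Sup K) - f (Inf K)))"
          by (rule sum_norm_le) auto
        also have "\<dots> = (\<Sum>(x, K)\<in>P. h K)"
          using part by (intro sum.cong) (auto simp: h_def dest: tagged_partial_division_ofD(2))
        also have "\<dots> = (\<Sum>K\<in>snd ` P. h K)"
          by (rule sum.over_tagged_division_lemma[OF tagged_partial_division_of_Union_self[OF part]])
             (auto simp: h_def dest: order_antisym)
        also have "\<dots> = (\<Sum>K\<in>snd ` P. norm (f (Sup K) - f (Inf K)))"
          using part by (intro sum.cong) (auto simp: h_def dest: tagged_partial_division_ofD(2))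
        also have "\<dots> < e / 2"
          using snd_int by (intro \<delta>[OF div _ small]) blast
        finally show ?thesis .
      qed
      have "(\<Sum>(x, k)\<in>\<D>. measure lborel k *\<^sub>R g x) - (f b - f a)
          = (\<Sum>(x, K)\<in>\<D>. measure lborel K *\<^sub>R g x - (f (Sup K) - f (Inf K)))"
        using additive_tagged_division_1[OF \<open>a \<le> b\<close> p, of f] by (simp add: split_def sum_subtractf)
      also have "\<dots> = (\<Sum>(x, K)\<in>\<D> - P. measure lborel K *\<^sub>R g x - (f (Sup K) - f (Inf K)))
          + (\<Sum>(x, K)\<in>P. measure lborel K *\<^sub>R g x - (f (Sup K) - f (Inf K)))"
        using fin P by (intro sum.subset_diff)
      finally show "norm ((\<Sum>(x, k)\<in>\<D>. measure lborel k *\<^sub>R g x) - (f b - f a)) < e"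
        using good bad e1 by (smt (verit) norm_triangle_ineq field_sum_of_halves)
    qed
  qed
  then show ?thesis
    by (rule has_integral_spike[OF \<open>negligible N\<close>, rotated]) (simp add: g_def)
qed

section \<open>Linear evolution equations with dissipative coefficients\<close>

lemma op_norm_nonneg: "0 \<le> op_norm A"
  unfolding op_norm_def by (intro onorm_pos_le matrix_vector_mul_bounded_linear)

lemma norm_mult_vec_le: "norm (A *v x) \<le> op_norm A * norm x"
  unfolding op_norm_def by (intro onorm matrix_vector_mul_bounded_linear)

lemma abs_continuous_on_increment_le:
  fixes f :: "real \<Rightarrow> 'a::banach"
  assumes "a \<le> b" "abs_continuous_on a b f" "negligible N" "0 \<le> C"
    and deriv: "\<And>x. x \<in> {a..b} - N \<Longrightarrow> (f has_vector_derivative f' x) (at x within {a..b})"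
    and le: "\<And>x. x \<in> {a..b} - N \<Longrightarrow> norm (f' x) \<le> C"
  shows "norm (f b - f a) \<le> C * (b - a)"
proof -
  have "(f' has_integral (f b - f a)) {a..b}"
    using assms(1-3) deriv by (rule fundamental_theorem_of_calculus_abs_continuous)
  then have "((\<lambda>x. if x \<in> N then 0 else f' x) has_integral (f b - f a)) (cbox a b)"
    unfolding box_real by (rule has_integral_spike[OF \<open>negligible N\<close>, rotated]) auto
  then have "norm (f b - f a) \<le> C * measure lborel (cbox a b)"
    by (rule has_integral_bound[OF \<open>0 \<le> C\<close>]) (use le \<open>0 \<le> C\<close> in auto)
  then show ?thesis using \<open>a \<le> b\<close> by simp
qed

text \<open>Formally \<open>|z|' = \<langle>z, z'\<rangle> / |z| \<le> g\<close>, but the norm is not differentiable where \<open>z\<close> vanishes. The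
  norm of \<open>(\<epsilon>, z)\<close> in the product space, which is \<open>sqrt (\<epsilon>\<^sup>2 + |z|\<^sup>2)\<close>, is smooth, is a
  1-Lipschitz function of \<open>z\<close>, and obeys the same inequality; then \<open>\<epsilon>\<close> tends to zero.\<close>

lemma energy_estimate:
  fixes z :: "real \<Rightarrow> 'a::euclidean_space"
  assumes "a \<le> b" "abs_continuous_on a b z" "negligible N"
    and deriv: "\<And>s. s \<in> {a..b} - N \<Longrightarrow> (z has_vector_derivative z' s) (at s within {a..b})"
    and energy: "\<And>s. s \<in> {a..b} - N \<Longrightarrow> z s \<bullet> z' s \<le> norm (z s) * g s"
    and g: "\<And>s. s \<in> {a..b} - N \<Longrightarrow> 0 \<le> g s" "g integrable_on {a..b}"
  shows "norm (z b) \<le> norm (z a) + integral {a..b} g"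
proof (rule field_le_epsilon)
  fix \<epsilon> :: real assume "0 < \<epsilon>"
  define \<phi> where "\<phi> = (\<lambda>s. norm (\<epsilon>, z s))"
  define \<phi>' where "\<phi>' = (\<lambda>s. if s \<in> N then 0 else (z s \<bullet> z' s) / \<phi> s)"
  have \<phi>_pos: "0 < \<phi> s" and le_\<phi>: "norm (z s) \<le> \<phi> s" for s
    using \<open>0 < \<epsilon>\<close> norm_snd_le[of "z s" \<epsilon>] by (auto simp: \<phi>_def prod_eq_iff)
  have \<phi>_eq: "\<phi> = (\<lambda>s. sqrt (\<epsilon>\<^sup>2 + z s \<bullet> z s))"
    by (simp add: \<phi>_def norm_Pair power2_norm_eq_inner)
  have "abs_continuous_on a b \<phi>"
  proof (rule abs_continuous_on_dominated[OF assms(2), of 1])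
    show "norm (\<phi> s - \<phi> t) \<le> 1 * norm (z s - z t)" for s t
      using norm_triangle_ineq3[of "(\<epsilon>, z s)" "(\<epsilon>, z t)"] by (simp add: \<phi>_def norm_Pair)
  qed auto
  moreover have "(\<phi> has_vector_derivative \<phi>' s) (at s within {a..b})" if "s \<in> {a..b} - N" for s
  proof -
    have "((\<lambda>s. z s \<bullet> z s) has_vector_derivative (z s \<bullet> z' s + z' s \<bullet> z s)) (at s within {a..b})"
      using deriv[OF that] by (intro bounded_bilinear.has_vector_derivative[OF bounded_bilinear_inner])
    then have "((\<lambda>s. z s \<bullet> z s) has_real_derivative (2 * (z s \<bullet> z' s))) (at s within {a..b})"
      by (simp add: has_real_derivative_iff_has_vector_derivative inner_commute)
    moreover have "0 < \<epsilon>\<^sup>2 + z s \<bullet> z s"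
      using \<open>0 < \<epsilon>\<close> by (simp add: add_pos_nonneg)
    ultimately have "(\<phi> has_real_derivative \<phi>' s) (at s within {a..b})"
      using that unfolding \<phi>_eq \<phi>'_def
      by (auto intro!: derivative_eq_intros simp: field_simps)
    then show ?thesis by (simp add: has_real_derivative_iff_has_vector_derivative)
  qed
  ultimately have "(\<phi>' has_integral (\<phi> b - \<phi> a)) {a..b}"
    using assms(1,3) by (intro fundamental_theorem_of_calculus_abs_continuous) auto
  moreover have "((\<lambda>s. if s \<in> N then 0 else g s) has_integral (integral {a..b} g)) {a..b}"
    by (rule has_integral_spike[OF \<open>negligible N\<close> _ integrable_integral[OF g(2)]]) auto
  moreover have "\<phi>' s \<le> (if s \<in> N then 0 else g s)" if "s \<in> {a..b}" for s
  proof (cases "s \<in> N")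
    case False
    then have "z s \<bullet> z' s \<le> \<phi> s * g s"
      using that energy[of s] mult_right_mono[OF le_\<phi>[of s] g(1)[of s]] by auto
    with False show ?thesis
      using \<phi>_pos[of s] by (simp add: \<phi>'_def field_simps)
  qed (simp add: \<phi>'_def)
  ultimately have "\<phi> b - \<phi> a \<le> integral {a..b} g"
    by (rule has_integral_le)
  moreover have "\<phi> a \<le> \<epsilon> + norm (z a)"
    using norm_Pair_le[of \<epsilon> "z a"] \<open>0 < \<epsilon>\<close> by (simp add: \<phi>_def)
  ultimately show "norm (z b) \<le> norm (z a) + integral {a..b} g + \<epsilon>"
    using le_\<phi>[of b] by simp
qed

text \<open>The exceptional set also absorbs the end points, since integrability constrains the input on the
  open interval only and the random matrix has a default value at the final time.\<close>

lemma solves_ivp_derivative: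
  assumes "solves_ivp T f x0 x"
  obtains N where "negligible N"
    "\<And>s. s \<in> {0..T} - N \<Longrightarrow> s \<in> {0<..<T} \<and> (x has_vector_derivative f s (x s)) (at s within {0..T})"
proof -
  have "AE s in lebesgue. s \<in> {0..T} \<longrightarrow> (x has_vector_derivative f s (x s)) (at s within {0..T})"
    using assms by (simp add: solves_ivp_def AE_restrict_space_iff)
  then obtain N where "negligible N"
    "{s. \<not> (s \<in> {0..T} \<longrightarrow> (x has_vector_derivative f s (x s)) (at s within {0..T}))} \<subseteq> N"
    unfolding eventually_ae_filter_negligible by blast
  then show thesis
    by (intro that[of "N \<union> {0, T}"]) auto
qed

text \<open>Only the values of the right-hand side along the trajectory matter. This turns the difference of two
  right-hand sides into a linear equation for the difference of the solutions, in whichever form is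
  convenient.\<close>

lemma solves_ivp_cong:
  assumes "solves_ivp T f x0 x" "\<And>s. s \<in> {0<..<T} \<Longrightarrow> f s (x s) = g s (x s)"
  shows "solves_ivp T g x0 x"
proof -
  obtain N where N: "negligible N"
    "\<And>s. s \<in> {0..T} - N \<Longrightarrow> s \<in> {0<..<T} \<and> (x has_vector_derivative f s (x s)) (at s within {0..T})"
    using solves_ivp_derivative[OF assms(1)] by metis
  have "s \<in> {0..T} \<longrightarrow> (x has_vector_derivative g s (x s)) (at s within {0..T})" if "s \<notin> N" for s
    using N(2)[of s] assms(2)[of s] that by auto
  then have "AE s in lebesgue. s \<in> {0..T} \<longrightarrow> (x has_vector_derivative g s (x s)) (at s within {0..T})"
    unfolding eventually_ae_filter_negligible using N(1) by blast
  with assms(1) show ?thesis by (simp add: solves_ivp_def AE_restrict_space_iff)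
qed

lemma solves_ivp_diff:
  assumes "solves_ivp T f x0 x" "solves_ivp T g y0 y"
  shows "solves_ivp T (\<lambda>s _. f s (x s) - g s (y s)) (x0 - y0) (\<lambda>s. x s - y s)"
proof -
  have "AE s in lebesgue_on {0..T}. ((\<lambda>s. x s - y s) has_vector_derivative f s (x s) - g s (y s)) (at s within {0..T})"
    using assms unfolding solves_ivp_def
    by (elim conjE) (rule eventually_elim2, assumption+, rule has_vector_derivative_diff)
  then show ?thesis
    using assms unfolding solves_ivp_def by (simp add: abs_continuous_on_diff)
qed

text \<open>A dissipative coefficient never increases the norm, so the norm grows at most at the rate of the
  forcing term. With \<open>g = 0\<close> and initial value \<open>0\<close> this is uniqueness of solutions.\<close>

lemma dissipative_growth:
  fixes z :: "real \<Rightarrow> real^'n"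
  assumes z: "solves_ivp T (\<lambda>s y. L s *v y + w s) z0 z" and t: "t \<in> {0..T}"
    and L: "\<And>s. s \<in> {0<..<t} \<Longrightarrow> dissipative (L s)"
    and w: "\<And>s. s \<in> {0<..<t} \<Longrightarrow> norm (w s) \<le> g s"
    and g: "g integrable_on {0..t}"
  shows "norm (z t) \<le> norm z0 + integral {0..t} g"
proof -
  obtain N where N: "negligible N"
    "\<And>s. s \<in> {0..T} - N \<Longrightarrow> s \<in> {0<..<T} \<and> (z has_vector_derivative L s *v z s + w s) (at s within {0..T})"
    using solves_ivp_derivative[OF z] by metis
  have sub: "{0..t} \<subseteq> {0..T}" using t by auto
  have "norm (z t) \<le> norm (z 0) + integral {0..t} g"
  proof (rule energy_estimate[where N = "N \<union> {0, t}" and z' = "\<lambda>s. L s *v z s + w s"])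
    show "abs_continuous_on 0 t z"
      using z sub abs_continuous_on_subinterval unfolding solves_ivp_def by blast
  next
    fix s assume s: "s \<in> {0..t} - (N \<union> {0, t})"
    then have s': "s \<in> {0<..<t}" by auto
    show "(z has_vector_derivative L s *v z s + w s) (at s within {0..t})"
      using N(2)[of s] s sub by (auto intro: has_vector_derivative_within_subset)
    have "z s \<bullet> (L s *v z s + w s) \<le> z s \<bullet> w s"
      using L[OF s'] by (simp add: dissipative_def inner_add_right)
    also have "\<dots> \<le> norm (z s) * norm (w s)" by (rule norm_cauchy_schwarz)
    also have "\<dots> \<le> norm (z s) * g s" using w[OF s'] by (simp add: mult_left_mono)
    finally show "z s \<bullet> (L s *v z s + w s) \<le> norm (z s) * g s" .
    show "0 \<le> g s" using w[OF s'] norm_ge_zero order_trans by blast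
  qed (use t N g in auto)
  then show ?thesis using z by (simp add: solves_ivp_def)
qed

text \<open>An interval has finite measure, and \<open>r \<le> 1 + r\<^sup>2\<close>.\<close>

lemma integrable_norm_of_in_L2:
  fixes B :: "real^'q^'n"
  assumes "in_Lp 2 T u"
  shows "integrable (lebesgue_on {0<..<T}) (\<lambda>s. norm (B *v u s))"
proof (rule Bochner_Integration.integrable_bound)
  have "integrable (lebesgue_on {0<..<T}) (\<lambda>s. norm (u s) powr 2)"
    using assms by (simp add: in_Lp_def)
  moreover have "integrable (lebesgue_on {0<..<T}) (\<lambda>s. 1::real)"
    by (intro finite_measure.integrable_const finite_measure_lebesgue_on) simp
  ultimately show "integrable (lebesgue_on {0<..<T}) (\<lambda>s. op_norm B * (1 + norm (u s) powr 2))"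
    by (intro integrable_mult_right Bochner_Integration.integrable_add)
  have "((*v) B) \<in> borel_measurable borel"
    by (intro borel_measurable_continuous_onI linear_continuous_on matrix_vector_mul_bounded_linear)
  then have "(\<lambda>s. B *v u s) \<in> borel_measurable (lebesgue_on {0<..<T})"
    using assms by (auto simp: in_Lp_def intro: measurable_compose)
  then show "(\<lambda>s. norm (B *v u s)) \<in> borel_measurable (lebesgue_on {0<..<T})" by measurable
  have "norm (B *v v) \<le> op_norm B * (1 + norm v powr 2)" for v
  proof -
    have "norm v \<le> 1 + norm v powr 2"
    proof -
      have "0 \<le> (norm v - 1)\<^sup>2 + norm v" by simp
      then show ?thesis by (simp add: power2_diff)
    qed
    then show ?thesis
      by (intro order_trans[OF norm_mult_vec_le] mult_left_mono op_norm_nonneg)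
  qed
  then have "norm (norm (B *v v)) \<le> norm (op_norm B * (1 + norm v powr 2))" for v
    unfolding real_norm_def abs_norm_cancel by (rule order_trans[OF _ abs_ge_self])
  then show "AE s in lebesgue_on {0<..<T}. norm (norm (B *v u s)) \<le> norm (op_norm B * (1 + norm (u s) powr 2))"
    by (intro AE_I2)
qed

lemma L1_norm_eq: "Lp_norm 1 T w = (LINT s|lebesgue_on {0<..<T}. norm (w s))"
proof -
  have 1: "(\<lambda>s. norm (w s) powr 1) = (\<lambda>s. norm (w s))"
    by (rule ext) (rule powr_one[OF norm_ge_zero])
  have 2: "0 \<le> (LINT s|lebesgue_on {0<..<T}. norm (w s))"
    by (rule Bochner_Integration.integral_nonneg) (rule norm_ge_zero)
  have 3: "Lp_norm 1 T w = (LINT s|lebesgue_on {0<..<T}. norm (w s)) powr 1"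
    by (simp only: Lp_norm_def 1 div_by_1)
  show ?thesis
    unfolding 3 by (rule powr_one[OF 2])
qed

lemma integral_norm_le_L1_norm:
  fixes B :: "real^'q^'n"
  assumes "in_Lp 2 T u" "t \<in> {0..T}"
  shows "(\<lambda>s. norm (B *v u s)) integrable_on {0..t}"
    and "integral {0..t} (\<lambda>s. norm (B *v u s)) \<le> Lp_norm 1 T (\<lambda>s. B *v u s)"
proof -
  let ?g = "\<lambda>s. norm (B *v u s)"
  have "(?g has_integral (LINT s|lebesgue_on {0<..<T}. ?g s)) {0<..<T}"
    by (intro has_integral_integral_lebesgue_on integrable_norm_of_in_L2 assms) simp
  then have T: "(?g has_integral (LINT s|lebesgue_on {0<..<T}. ?g s)) {0..T}"
    using has_integral_open_interval[of ?g _ 0 T] by simp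
  note L1 = L1_norm_eq[of T "\<lambda>s. B *v u s"]
  show int: "(\<lambda>s. norm (B *v u s)) integrable_on {0..t}"
    by (rule integrable_on_subinterval[OF has_integral_integrable[OF T]]) (use assms(2) in auto)
  show "integral {0..t} ?g \<le> Lp_norm 1 T (\<lambda>s. B *v u s)"
    unfolding L1 by (rule has_integral_subset_le[OF _ integrable_integral[OF int] T]) (use assms(2) in auto)
qed

section \<open>The probability space of paths\<close>

lemma finite_Omega_paths: "finite (Omega_paths M K)"
  by (simp add: Omega_paths_def Omega_def finite_PiE)

lemma Omega_paths_mem: "\<xi> \<in> Omega_paths M K \<Longrightarrow> k \<in> {1..K} \<Longrightarrow> \<xi> k \<in> Omega M"
  by (auto simp: Omega_paths_def)

lemma Omega_paths_update:
  "\<xi> \<in> Omega_paths M K \<Longrightarrow> k \<in> {1..K} \<Longrightarrow> v \<in> Omega M \<Longrightarrow> \<xi>(k := v) \<in> Omega_paths M K"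
  by (auto simp: Omega_paths_def PiE_iff extensional_def)

lemma expect_add: "expect M p K (\<lambda>\<xi>. X \<xi> + Y \<xi>) = expect M p K X + expect M p K Y"
  by (simp add: expect_def sum.distrib algebra_simps)

lemma expect_cmult: "expect M p K (\<lambda>\<xi>. c * X \<xi>) = c * expect M p K X"
  by (simp add: expect_def sum_distrib_left mult_ac)

lemma expect_mono:
  assumes "\<And>v. v \<in> Omega M \<Longrightarrow> 0 \<le> p v" "\<And>\<xi>. \<xi> \<in> Omega_paths M K \<Longrightarrow> X \<xi> \<le> Y \<xi>"
  shows "expect M p K X \<le> expect M p K Y"
  unfolding expect_def
  by (intro sum_mono mult_right_mono prod_nonneg ballI assms) (auto intro: Omega_paths_mem)

lemma expect_cong:
  "(\<And>\<xi>. \<xi> \<in> Omega_paths M K \<Longrightarrow> X \<xi> = Y \<xi>) \<Longrightarrow> expect M p K X = expect M p K Y"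
  by (simp add: expect_def)

lemma expect_const:
  assumes "(\<Sum>v\<in>Omega M. p v) = 1"
  shows "expect M p K (\<lambda>_. c) = c"
proof -
  have "(\<Sum>\<xi>\<in>Omega_paths M K. \<Prod>k=1..K. p (\<xi> k)) = (\<Prod>k=1..K. \<Sum>v\<in>Omega M. p v)"
    unfolding Omega_paths_def by (rule prod_sum_PiE[symmetric]) (auto simp: Omega_def)
  with assms show ?thesis by (simp add: expect_def sum_distrib_left[symmetric])
qed

lemma expect_split_coordinate:
  assumes "k \<in> {1..K}"
  shows "expect M p K X = (\<Sum>v\<in>Omega M. \<Sum>g\<in>Pi\<^sub>E ({1..K} - {k}) (\<lambda>_. Omega M).
    p v * (X (g(k := v)) * (\<Prod>j\<in>{1..K} - {k}. p (g j))))"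
proof -
  let ?J = "{1..K} - {k}"
  have K: "{1..K} = insert k ?J" using assms by auto
  have "expect M p K X = (\<Sum>(v, g)\<in>Omega M \<times> Pi\<^sub>E ?J (\<lambda>_. Omega M).
      X (g(k := v)) * (\<Prod>j\<in>{1..K}. p ((g(k := v)) j)))"
  proof -
    have "Omega_paths M K = (\<lambda>(y, g). g(k := y)) ` (Omega M \<times> Pi\<^sub>E ?J (\<lambda>_. Omega M))"
      unfolding Omega_paths_def by (subst K) (simp only: PiE_insert_eq)
    moreover have "inj_on (\<lambda>(y, g). g(k := y)) (Omega M \<times> Pi\<^sub>E ?J (\<lambda>_. Omega M))"
      using inj_combinator[of k ?J "\<lambda>_. Omega M"] by simp
    ultimately show ?thesis
      unfolding expect_def by (simp add: sum.reindex case_prod_unfold)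
  qed
  also have "\<dots> = (\<Sum>(v, g)\<in>Omega M \<times> Pi\<^sub>E ?J (\<lambda>_. Omega M).
      p v * (X (g(k := v)) * (\<Prod>j\<in>?J. p (g j))))"
  proof (rule sum.cong, simp, clarify)
    fix v g
    have "(\<Prod>j\<in>{1..K}. p ((g(k := v)) j)) = p v * (\<Prod>j\<in>?J. p ((g(k := v)) j))"
      using assms by (subst prod.remove[of _ k]) auto
    also have "(\<Prod>j\<in>?J. p ((g(k := v)) j)) = (\<Prod>j\<in>?J. p (g j))"
      by (rule prod.cong) auto
    finally show "X (g(k := v)) * (\<Prod>j\<in>{1..K}. p ((g(k := v)) j))
        = p v * (X (g(k := v)) * (\<Prod>j\<in>?J. p (g j)))" by simp
  qed
  finally show ?thesis by (simp add: sum.cartesian_product)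
qed

text \<open>Drawing one coordinate afresh does not change the law of a path. This is the form in which
  independence of the indices is used: if a factor of the integrand does not react to the update, it
  can be taken out of the inner sum.\<close>

lemma expect_resample:
  assumes "(\<Sum>v\<in>Omega M. p v) = 1" "k \<in> {1..K}"
  shows "expect M p K X = expect M p K (\<lambda>\<xi>. \<Sum>v\<in>Omega M. p v * X (\<xi>(k := v)))"
proof -
  let ?G = "Pi\<^sub>E ({1..K} - {k}) (\<lambda>_. Omega M)" and ?w = "\<lambda>g. \<Prod>j\<in>{1..K} - {k}. p (g j)"
  have "expect M p K (\<lambda>\<xi>. \<Sum>v\<in>Omega M. p v * X (\<xi>(k := v)))
      = (\<Sum>v'\<in>Omega M. p v' * (\<Sum>g\<in>?G. \<Sum>v\<in>Omega M. p v * (X (g(k := v)) * ?w g)))"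
    unfolding expect_split_coordinate[OF assms(2)]
    by (simp add: sum_distrib_left sum_distrib_right mult.assoc)
  also have "\<dots> = (\<Sum>g\<in>?G. \<Sum>v\<in>Omega M. p v * (X (g(k := v)) * ?w g))"
    using assms(1) by (simp add: sum_distrib_right[symmetric])
  also have "\<dots> = expect M p K X"
    unfolding expect_split_coordinate[OF assms(2)] by (rule sum.swap)
  finally show ?thesis ..
qed

lemma expect_coordinate:
  assumes "(\<Sum>v\<in>Omega M. p v) = 1" "k \<in> {1..K}"
  shows "expect M p K (\<lambda>\<xi>. \<phi> (\<xi> k)) = (\<Sum>v\<in>Omega M. p v * \<phi> v)"
  by (subst expect_resample[OF assms]) (simp add: expect_const[OF assms(1)])

lemma has_integral_expect:
  fixes f :: "(nat \<Rightarrow> nat) \<Rightarrow> real \<Rightarrow> real"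
  assumes "\<And>\<xi>. \<xi> \<in> Omega_paths M K \<Longrightarrow> (f \<xi> has_integral I \<xi>) S"
  shows "((\<lambda>s. expect M p K (\<lambda>\<xi>. f \<xi> s)) has_integral expect M p K I) S"
  unfolding expect_def
  by (intro has_integral_sum finite_Omega_paths has_integral_mult_left assms)

lemma sum_matrix_vector_mult: "(\<Sum>i\<in>I. F i) *v y = (\<Sum>i\<in>I. F i *v (y :: real^'n))"
  by (induction I rule: infinite_finite_induct) (auto simp: matrix_vector_mult_add_rdistrib)

section \<open>Randomly sampled splittings\<close>

locale randomized_splitting =
  fixes A :: "real^'n^'n" and Am :: "nat \<Rightarrow> real^'n^'n" and M K :: nat
    and S :: "nat \<Rightarrow> nat set" and p :: "nat \<Rightarrow> real" and T :: real and \<tau> :: "nat \<Rightarrow> real"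
  assumes splitting: "A = (\<Sum>m=1..M. Am m)"
    and enum: "enumerates_subsets M S"
    and p_nonneg: "\<And>v. v \<in> Omega M \<Longrightarrow> p v \<ge> 0"
    and grid: "is_grid T K \<tau>"
    and diss: "\<And>m. m \<in> {1..M} \<Longrightarrow> dissipative (Am m)"
    and p_sum: "(\<Sum>v\<in>Omega M. p v) = 1"
    and sel_pos: "\<And>m. m \<in> {1..M} \<Longrightarrow> sel_prob M S p m > 0"
begin

abbreviation E where "E \<equiv> expect M p K"
abbreviation sampled where "sampled \<equiv> sampled_matrix M S p Am"
abbreviation rand where "rand \<equiv> random_matrix M S p Am K \<tau>"
abbreviation V where "V \<equiv> Var_matrix M S p Am A"
abbreviation h where "h \<equiv> max_spacing K \<tau>"

text \<open>\<open>dev v\<close> measures how far the sample \<open>v\<close> is from \<open>A\<close>, and \<open>path_dev \<xi> s\<close> is the deviation seen by the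
  path \<open>\<xi>\<close> at time \<open>s\<close>. On the \<open>k\<close>-th cell the latter is \<open>dev (\<xi> k)\<close>.\<close>

definition dev :: "nat \<Rightarrow> real" where "dev v = op_norm (sampled v - A)"

definition path_dev :: "(nat \<Rightarrow> nat) \<Rightarrow> real \<Rightarrow> real" where
  "path_dev \<xi> s = op_norm (rand \<xi> s - A)"

lemma subset_of_Omega: "v \<in> Omega M \<Longrightarrow> S v \<subseteq> {1..M}"
  using enum by (auto simp: enumerates_subsets_def bij_betw_def)

lemma dissipative_sampled:
  assumes "v \<in> Omega M" shows "dissipative (sampled v)"
  unfolding dissipative_def
proof
  fix y :: "real^'n"
  have "y \<bullet> (sampled v *v y) = (\<Sum>m\<in>S v. (1 / sel_prob M S p m) * (y \<bullet> (Am m *v y)))"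
    by (simp add: sampled_matrix_def sum_matrix_vector_mult inner_sum_right
        scaleR_matrix_vector_assoc[symmetric])
  also have "\<dots> \<le> 0"
  proof (intro sum_nonpos mult_nonneg_nonpos)
    fix m assume "m \<in> S v"
    then have "m \<in> {1..M}" using subset_of_Omega[OF assms] by blast
    then show "0 \<le> 1 / sel_prob M S p m" "y \<bullet> (Am m *v y) \<le> 0"
      using sel_pos[of m] diss[of m] by (auto simp: dissipative_def)
  qed
  finally show "y \<bullet> (sampled v *v y) \<le> 0" .
qed

lemma dissipative_A: "dissipative A"
  using diss by (auto simp: dissipative_def splitting sum_matrix_vector_mult inner_sum_right intro!: sum_nonpos)

text \<open>The weights \<open>1 / sel_prob M S p m\<close> make the sample unbiased: after exchanging the sums, \<open>Am m\<close> carries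
  the total probability of the subsets containing \<open>m\<close>, divided by that same number.\<close>

lemma mean_sampled: "(\<Sum>v\<in>Omega M. p v *\<^sub>R sampled v) = A"
proof -
  have fin: "finite (Omega M)" by (simp add: Omega_def)
  have "(\<Sum>v\<in>Omega M. p v *\<^sub>R sampled v)
      = (\<Sum>v\<in>Omega M. \<Sum>m\<in>{m\<in>{1..M}. m \<in> S v}. (p v / sel_prob M S p m) *\<^sub>R Am m)"
  proof (rule sum.cong)
    fix v assume "v \<in> Omega M"
    then have "{m\<in>{1..M}. m \<in> S v} = S v" using subset_of_Omega by blast
    then show "p v *\<^sub>R sampled v = (\<Sum>m\<in>{m\<in>{1..M}. m \<in> S v}. (p v / sel_prob M S p m) *\<^sub>R Am m)"
      by (simp add: sampled_matrix_def scaleR_sum_right)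
  qed simp
  also have "\<dots> = (\<Sum>m=1..M. \<Sum>v\<in>{v\<in>Omega M. m \<in> S v}. (p v / sel_prob M S p m) *\<^sub>R Am m)"
    using fin by (intro sum.swap_restrict) auto
  also have "\<dots> = (\<Sum>m=1..M. Am m)"
  proof (rule sum.cong)
    fix m assume "m \<in> {1..M}"
    then have "sel_prob M S p m \<noteq> 0" using sel_pos[of m] by simp
    then show "(\<Sum>v\<in>{v\<in>Omega M. m \<in> S v}. (p v / sel_prob M S p m) *\<^sub>R Am m) = Am m"
      by (simp add: scaleR_sum_left[symmetric] sum_divide_distrib[symmetric] flip: sel_prob_def)
  qed simp
  finally show ?thesis by (simp add: splitting)
qed

lemma mean_deviation: "(\<Sum>v\<in>Omega M. p v *\<^sub>R ((sampled v - A) *v y)) = 0"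
proof -
  have "(\<Sum>v\<in>Omega M. p v *\<^sub>R ((sampled v - A) *v y)) = (\<Sum>v\<in>Omega M. p v *\<^sub>R (sampled v - A)) *v y"
    by (simp add: sum_matrix_vector_mult scaleR_matrix_vector_assoc)
  also have "(\<Sum>v\<in>Omega M. p v *\<^sub>R (sampled v - A)) = 0"
    using mean_sampled p_sum by (simp add: scaleR_diff_right sum_subtractf flip: scaleR_sum_left)
  finally show ?thesis by simp
qed

lemma grid_mono: "i \<le> j \<Longrightarrow> j \<le> K \<Longrightarrow> \<tau> i \<le> \<tau> j"
proof (induction j rule: dec_induct)
  case (step j)
  then have "\<tau> (Suc j - 1) < \<tau> (Suc j)" using grid unfolding is_grid_def by force
  with step show ?case by simp
qed simp

lemma grid_step: "k \<in> {1..K} \<Longrightarrow> \<tau> (k - 1) < \<tau> k"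
  using grid by (simp add: is_grid_def)

lemma grid_range: "k \<le> K \<Longrightarrow> \<tau> k \<in> {0..T}"
  using grid_mono[of 0 k] grid_mono[of k K] grid by (simp add: is_grid_def)

lemma grid_cell_range:
  assumes "k \<in> {1..K}" shows "\<tau> (k - 1) \<in> {0..T}" "\<tau> k \<in> {0..T}"
  using assms grid_range[of "k - 1"] grid_range[of k] by auto

lemma grid_spacing: "k \<in> {1..K} \<Longrightarrow> \<tau> k - \<tau> (k - 1) \<le> h"
  unfolding max_spacing_def by (rule Max_ge) auto

lemma obtain_cell:
  assumes "s \<in> {0..<T}"
  obtains k where "k \<in> {1..K}" "s \<in> {\<tau> (k - 1)..<\<tau> k}"
proof -
  define k where "k = (LEAST k. s < \<tau> k)"
  have ex: "s < \<tau> K" using assms grid by (simp add: is_grid_def)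
  have "s < \<tau> k" unfolding k_def using ex by (rule LeastI)
  have "k \<le> K" unfolding k_def using ex by (rule Least_le)
  have "k \<noteq> 0" using \<open>s < \<tau> k\<close> assms grid by (metis atLeastLessThan_iff is_grid_def not_less)
  moreover from this have "\<not> s < \<tau> (k - 1)"
    unfolding k_def by (intro not_less_Least) simp
  ultimately show thesis
    using \<open>k \<le> K\<close> \<open>s < \<tau> k\<close> by (intro that[of k]) auto
qed

lemma cell_unique:
  assumes "k \<in> {1..K}" "s \<in> {\<tau> (k - 1)..<\<tau> k}" "j \<in> {1..K}"
  shows "s \<in> {\<tau> (j - 1)..<\<tau> j} \<longleftrightarrow> j = k"
proof
  assume j: "s \<in> {\<tau> (j - 1)..<\<tau> j}"
  show "j = k"
  proof (rule ccontr)
    assume "j \<noteq> k"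
    then consider "j \<le> k - 1" | "k \<le> j - 1" by linarith
    then show False
    proof cases
      case 1
      moreover have "k - 1 \<le> K" using assms(1) by auto
      ultimately have "\<tau> j \<le> \<tau> (k - 1)" by (rule grid_mono)
      then show False using j assms(2) by simp
    next
      case 2
      moreover have "j - 1 \<le> K" using assms(3) by auto
      ultimately have "\<tau> k \<le> \<tau> (j - 1)" by (rule grid_mono)
      then show False using j assms(2) by simp
    qed
  qed
qed (use assms in simp)

lemma rand_cell:
  assumes "k \<in> {1..K}" "s \<in> {\<tau> (k - 1)..<\<tau> k}"
  shows "rand \<xi> s = sampled (\<xi> k)"
proof -
  have "rand \<xi> s = (\<Sum>j=1..K. if j = k then sampled (\<xi> j) else 0)"
    unfolding random_matrix_def by (intro sum.cong refl if_cong cell_unique[OF assms])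
  then show ?thesis using assms(1) by simp
qed

lemma path_dev_cell:
  "k \<in> {1..K} \<Longrightarrow> s \<in> {\<tau> (k - 1)..<\<tau> k} \<Longrightarrow> path_dev \<xi> s = dev (\<xi> k)"
  by (simp add: path_dev_def dev_def rand_cell)

lemma dissipative_rand:
  assumes "\<xi> \<in> Omega_paths M K" "s \<in> {0..<T}" shows "dissipative (rand \<xi> s)"
  using assms by (metis obtain_cell rand_cell dissipative_sampled Omega_paths_mem)

lemma dev_nonneg: "0 \<le> dev v" and path_dev_nonneg: "0 \<le> path_dev \<xi> s"
  by (simp_all add: dev_def path_dev_def op_norm_nonneg)

lemma path_dev_integrable:
  assumes "t \<in> {0..T}"
  shows "path_dev \<xi> integrable_on {0..t}"
proof (rule integrable_spike[where S = "{T}"])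
  show "(\<lambda>s. \<Sum>k=1..K. dev (\<xi> k) * indicat_real {\<tau> (k - 1)..<\<tau> k} s) integrable_on {0..t}"
  proof (intro integrable_sum integrable_on_mult_right finite_atLeastAtMost)
    show "indicat_real {\<tau> (k - 1)..<\<tau> k} integrable_on {0..t}" for k
      unfolding integrable_on_indicator
      by (metis bounded_set_imp_lmeasurable bounded_Int bounded_closed_interval sets.Int
          sets_completionI_sets sets_lborel atLeastLessThan_borel atLeastAtMost_borel)
  qed
  fix s assume "s \<in> {0..t} - {T}"
  then have "s \<in> {0..<T}" using assms by auto
  then obtain k where k: "k \<in> {1..K}" "s \<in> {\<tau> (k - 1)..<\<tau> k}" by (rule obtain_cell)
  have "(\<Sum>j=1..K. dev (\<xi> j) * indicat_real {\<tau> (j - 1)..<\<tau> j} s) = (\<Sum>j=1..K. if j = k then dev (\<xi> j) else 0)"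
  proof (rule sum.cong)
    fix j assume "j \<in> {1..K}"
    then show "dev (\<xi> j) * indicat_real {\<tau> (j - 1)..<\<tau> j} s = (if j = k then dev (\<xi> j) else 0)"
      using cell_unique[OF k, of j] by (simp only: indicator_def) simp
  qed simp
  then show "path_dev \<xi> s = (\<Sum>k=1..K. dev (\<xi> k) * indicat_real {\<tau> (k - 1)..<\<tau> k} s)"
    using k(1) by (simp add: path_dev_cell[OF k])
qed simp

lemma expect_dev_square: "k \<in> {1..K} \<Longrightarrow> E (\<lambda>\<xi>. (dev (\<xi> k))\<^sup>2) = V"
  by (subst expect_coordinate[OF p_sum]) (auto simp: Var_matrix_def dev_def mult.commute)

text \<open>The inequality \<open>2 a b \<le> a\<^sup>2 + b\<^sup>2\<close> treats \<open>j = k\<close> and \<open>j \<noteq> k\<close> alike.\<close>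

lemma expect_dev_product:
  assumes "j \<in> {1..K}" "k \<in> {1..K}"
  shows "E (\<lambda>\<xi>. dev (\<xi> j) * dev (\<xi> k)) \<le> V"
proof -
  have "dev a * dev b \<le> (1/2) * (dev a)\<^sup>2 + (1/2) * (dev b)\<^sup>2" for a b
    using zero_le_power2[of "dev a - dev b"] by (simp add: power2_diff)
  then have "E (\<lambda>\<xi>. dev (\<xi> j) * dev (\<xi> k)) \<le> E (\<lambda>\<xi>. (1/2) * (dev (\<xi> j))\<^sup>2 + (1/2) * (dev (\<xi> k))\<^sup>2)"
    by (intro expect_mono p_nonneg)
  also have "\<dots> = V"
    unfolding expect_add expect_cmult expect_dev_square[OF assms(1)] expect_dev_square[OF assms(2)] by simp
  finally show ?thesis .
qed

text \<open>Expectation and integral are exchanged, and at each time the integrand is a product of two deviations.\<close>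

lemma expect_dev_integral:
  assumes "k \<in> {1..K}" "t \<in> {0..T}"
  shows "E (\<lambda>\<xi>. dev (\<xi> k) * integral {0..t} (path_dev \<xi>)) \<le> V * t"
proof (rule has_integral_le)
  have "((\<lambda>s. E (\<lambda>\<xi>. dev (\<xi> k) * path_dev \<xi> s)) has_integral
      E (\<lambda>\<xi>. dev (\<xi> k) * integral {0..t} (path_dev \<xi>))) {0..t}"
    by (intro has_integral_expect has_integral_mult_right integrable_integral path_dev_integrable assms)
  \<comment> \<open>The final time lies in no cell; the integrand is changed at this single point.\<close>
  then show "((\<lambda>s. if s = T then V else E (\<lambda>\<xi>. dev (\<xi> k) * path_dev \<xi> s)) has_integral
      E (\<lambda>\<xi>. dev (\<xi> k) * integral {0..t} (path_dev \<xi>))) {0..t}"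
    by (rule has_integral_spike[of "{T}", rotated 2]) auto
  show "((\<lambda>s. V) has_integral V * t) {0..t}"
    using has_integral_const_real[of V 0 t] assms(2) by (simp add: mult.commute)
  fix s assume s: "s \<in> {0..t}"
  show "(if s = T then V else E (\<lambda>\<xi>. dev (\<xi> k) * path_dev \<xi> s)) \<le> V"
  proof (cases "s = T")
    case False
    then have "s \<in> {0..<T}" using s assms(2) by auto
    then obtain j where "j \<in> {1..K}" "s \<in> {\<tau> (j - 1)..<\<tau> j}" by (rule obtain_cell)
    then show ?thesis using False expect_dev_product[OF assms(1), of j] by (simp add: path_dev_cell)
  qed simp
qed

end

section \<open>The error of the randomized solution\<close>

locale splitting_solutions = randomized_splitting A Am M K S p T \<tau>
  for A :: "real^'n^'n" and Am :: "nat \<Rightarrow> real^'n^'n" and M K :: nat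
    and S :: "nat \<Rightarrow> nat set" and p :: "nat \<Rightarrow> real" and T :: real and \<tau> :: "nat \<Rightarrow> real" +
  fixes B :: "real^'q^'n" and u :: "real \<Rightarrow> real^'q" and x0 :: "real^'n"
    and x :: "real \<Rightarrow> real^'n" and xh :: "(nat \<Rightarrow> nat) \<Rightarrow> real \<Rightarrow> real^'n"
  assumes u: "in_Lp 2 T u"
    and x: "solves_ivp T (\<lambda>s y. A *v y + B *v u s) x0 x"
    and xh: "\<And>\<xi>. \<xi> \<in> Omega_paths M K \<Longrightarrow>
      solves_ivp T (\<lambda>s y. rand \<xi> s *v y + B *v u s) x0 (xh \<xi>)"
begin

text \<open>A common bound for the solution and all randomized solutions.\<close>

definition R :: real where "R = norm x0 + Lp_norm 1 T (\<lambda>s. B *v u s)"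

definition err :: "(nat \<Rightarrow> nat) \<Rightarrow> real \<Rightarrow> real^'n" where "err \<xi> s = xh \<xi> s - x s"

lemma solution_bound:
  assumes z: "solves_ivp T (\<lambda>s y. L s *v y + B *v u s) x0 z" and t: "t \<in> {0..T}"
    and L: "\<And>s. s \<in> {0<..<T} \<Longrightarrow> dissipative (L s)"
  shows "norm (z t) \<le> R"
proof -
  have "norm (z t) \<le> norm x0 + integral {0..t} (\<lambda>s. norm (B *v u s))"
    by (rule dissipative_growth[OF z t]) (use t in \<open>auto intro: L integral_norm_le_L1_norm(1)[OF u]\<close>)
  also have "\<dots> \<le> R"
    unfolding R_def using integral_norm_le_L1_norm(2)[OF u t] by simp
  finally show ?thesis .
qed

lemma x_bound: "t \<in> {0..T} \<Longrightarrow> norm (x t) \<le> R"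
  using solution_bound[OF x] dissipative_A by simp

lemma xh_bound: "\<xi> \<in> Omega_paths M K \<Longrightarrow> t \<in> {0..T} \<Longrightarrow> norm (xh \<xi> t) \<le> R"
  using solution_bound[OF xh] dissipative_rand by simp

lemma R_nonneg: "0 \<le> R"
  unfolding R_def by (simp add: L1_norm_eq)

lemma err_bound:
  assumes "\<xi> \<in> Omega_paths M K" "t \<in> {0..T}"
  shows "norm (err \<xi> t) \<le> 2 * R"
  unfolding err_def using norm_triangle_ineq4[of "xh \<xi> t" "x t"] xh_bound[OF assms] x_bound[OF assms(2)]
  by linarith

text \<open>The error equation with the random matrix acting on the error, which makes dissipativity available.\<close>

lemma err_equation:
  assumes "\<xi> \<in> Omega_paths M K"
  shows "solves_ivp T (\<lambda>s y. rand \<xi> s *v y + (rand \<xi> s - A) *v x s) 0 (err \<xi>)"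
  unfolding err_def[abs_def]
  using solves_ivp_diff[OF xh[OF assms] x, unfolded diff_self]
  by (rule solves_ivp_cong)
     (simp add: matrix_vector_mult_diff_distrib matrix_vector_mult_diff_rdistrib)

text \<open>The same equation with \<open>A\<close> acting on the error. Here the deviation multiplies the bounded function
  \<open>xh \<xi>\<close>, so that the norm of the random matrix itself never enters an estimate.\<close>

lemma err_equation_perturbed:
  assumes "\<xi> \<in> Omega_paths M K"
  shows "solves_ivp T (\<lambda>s y. A *v y + (rand \<xi> s - A) *v xh \<xi> s) 0 (err \<xi>)"
  unfolding err_def[abs_def]
  using solves_ivp_diff[OF xh[OF assms] x, unfolded diff_self]
  by (rule solves_ivp_cong)
     (simp add: matrix_vector_mult_diff_distrib matrix_vector_mult_diff_rdistrib)

lemma err_growth: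
  assumes \<xi>: "\<xi> \<in> Omega_paths M K" and t: "t \<in> {0..T}"
  shows "norm (err \<xi> t) \<le> R * integral {0..t} (path_dev \<xi>)"
proof -
  have "norm (err \<xi> t) \<le> norm (0 :: real^'n) + integral {0..t} (\<lambda>s. R * path_dev \<xi> s)"
  proof (rule dissipative_growth[OF err_equation[OF \<xi>] t])
    fix s assume "s \<in> {0<..<t}"
    then have s: "s \<in> {0..T}" "s \<in> {0..<T}" using t by auto
    show "dissipative (rand \<xi> s)" using \<xi> s(2) by (rule dissipative_rand)
    show "norm ((rand \<xi> s - A) *v x s) \<le> R * path_dev \<xi> s"
      unfolding path_dev_def mult.commute[of R]
      by (rule order_trans[OF norm_mult_vec_le mult_left_mono[OF x_bound[OF s(1)] op_norm_nonneg]])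
  qed (intro integrable_on_mult_right path_dev_integrable t)
  then show ?thesis by simp
qed

text \<open>Two paths that differ in the index \<open>k\<close> only see the same matrix until the \<open>k\<close>-th cell begins; the
  difference of their solutions then has no forcing up to that time.\<close>

lemma err_independent:
  assumes \<xi>: "\<xi> \<in> Omega_paths M K" and k: "k \<in> {1..K}" and v: "v \<in> Omega M"
  shows "err (\<xi>(k := v)) (\<tau> (k - 1)) = err \<xi> (\<tau> (k - 1))"
proof -
  let ?\<xi>' = "\<xi>(k := v)" and ?t = "\<tau> (k - 1)"
  have \<xi>': "?\<xi>' \<in> Omega_paths M K" using \<xi> k v by (rule Omega_paths_update)
  have t: "?t \<in> {0..T}" "\<tau> k \<in> {0..T}" using k by (rule grid_cell_range)+
  have d: "solves_ivp T (\<lambda>s y. rand ?\<xi>' s *v y + (rand ?\<xi>' s - rand \<xi> s) *v xh \<xi> s) 0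
      (\<lambda>s. xh ?\<xi>' s - xh \<xi> s)"
    using solves_ivp_diff[OF xh[OF \<xi>'] xh[OF \<xi>], unfolded diff_self]
    by (rule solves_ivp_cong)
       (simp add: matrix_vector_mult_diff_distrib matrix_vector_mult_diff_rdistrib)
  have "norm (xh ?\<xi>' ?t - xh \<xi> ?t) \<le> norm (0 :: real^'n) + integral {0..?t} (\<lambda>_. 0)"
  proof (rule dissipative_growth[OF d t(1)])
    fix s assume s: "s \<in> {0<..<?t}"
    then have sT: "s \<in> {0..<T}" using t(1) by auto
    show "dissipative (rand ?\<xi>' s)" using \<xi>' sT by (rule dissipative_rand)
    obtain j where j: "j \<in> {1..K}" "s \<in> {\<tau> (j - 1)..<\<tau> j}" using sT by (rule obtain_cell)
    have "j \<noteq> k" using j(2) s by auto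
    then have "rand ?\<xi>' s = rand \<xi> s" by (simp add: rand_cell[OF j])
    then show "norm ((rand ?\<xi>' s - rand \<xi> s) *v xh \<xi> s) \<le> 0" by simp
  qed (rule integrable_0)
  then show ?thesis by (simp add: err_def)
qed

text \<open>By the second form of the error equation the speed of the error within the cell is at most
  \<open>\<parallel>A\<parallel> |e| + dev (\<xi> k) R\<close>, where \<open>|e|\<close> is bounded by its growth estimate.\<close>

lemma err_increment:
  assumes \<xi>: "\<xi> \<in> Omega_paths M K" and k: "k \<in> {1..K}" and t: "t \<in> {\<tau> (k - 1)..<\<tau> k}"
  shows "norm (err \<xi> t - err \<xi> (\<tau> (k - 1)))
    \<le> h * R * (op_norm A * integral {0..t} (path_dev \<xi>) + dev (\<xi> k))"
proof -
  let ?a = "\<tau> (k - 1)" and ?I = "\<lambda>t. integral {0..t} (path_dev \<xi>)"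
  let ?C = "R * (op_norm A * ?I t + dev (\<xi> k))"
  have range: "?a \<in> {0..T}" "\<tau> k \<in> {0..T}" using k by (rule grid_cell_range)+
  have sub: "{?a..t} \<subseteq> {0..T}" and tT: "t \<in> {0..T}" using range t by auto
  obtain N where N: "negligible N" and deriv: "\<And>s. s \<in> {0..T} - N \<Longrightarrow>
      (err \<xi> has_vector_derivative A *v err \<xi> s + (rand \<xi> s - A) *v xh \<xi> s) (at s within {0..T})"
    using solves_ivp_derivative[OF err_equation_perturbed[OF \<xi>]] by metis
  have "0 \<le> R" by (rule R_nonneg)
  have I_nonneg: "0 \<le> ?I t"
    using tT by (intro integral_nonneg path_dev_integrable path_dev_nonneg)
  have C_nonneg: "0 \<le> ?C"
    using \<open>0 \<le> R\<close> I_nonneg by (intro mult_nonneg_nonneg add_nonneg_nonneg op_norm_nonneg dev_nonneg)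
  have "norm (err \<xi> t - err \<xi> ?a) \<le> ?C * (t - ?a)"
  proof (rule abs_continuous_on_increment_le[OF _ _ N C_nonneg])
    show "?a \<le> t" using t by simp
    show "abs_continuous_on ?a t (err \<xi>)"
      using err_equation[OF \<xi>] sub abs_continuous_on_subinterval unfolding solves_ivp_def by blast
    fix s assume s: "s \<in> {?a..t} - N"
    then have sT: "s \<in> {0..T}" and cell: "s \<in> {?a..<\<tau> k}" and st: "s \<le> t"
      using sub t by auto
    show "(err \<xi> has_vector_derivative A *v err \<xi> s + (rand \<xi> s - A) *v xh \<xi> s) (at s within {?a..t})"
      using deriv[of s] s sT sub by (auto intro: has_vector_derivative_within_subset)
    have "?I s \<le> ?I t"
      using st sT tT by (intro integral_subset_le path_dev_integrable) (auto intro: path_dev_nonneg)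
    then have "norm (err \<xi> s) \<le> R * ?I t"
      using err_growth[OF \<xi> sT] mult_left_mono[OF _ \<open>0 \<le> R\<close>] order_trans by blast
    then have "norm (A *v err \<xi> s) \<le> op_norm A * (R * ?I t)"
      by (intro order_trans[OF norm_mult_vec_le] mult_left_mono op_norm_nonneg)
    moreover have "norm ((rand \<xi> s - A) *v xh \<xi> s) \<le> dev (\<xi> k) * R"
      unfolding rand_cell[OF k cell] dev_def
      by (rule order_trans[OF norm_mult_vec_le mult_left_mono[OF xh_bound[OF \<xi> sT] op_norm_nonneg]])
    ultimately have "norm (A *v err \<xi> s + (rand \<xi> s - A) *v xh \<xi> s) \<le> op_norm A * (R * ?I t) + dev (\<xi> k) * R"
      by (rule norm_triangle_mono)
    then show "norm (A *v err \<xi> s + (rand \<xi> s - A) *v xh \<xi> s) \<le> ?C"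
      by (simp add: algebra_simps)
  qed
  also have "\<dots> \<le> ?C * h"
    using grid_spacing[OF k] t C_nonneg by (intro mult_left_mono) auto
  finally show ?thesis by (simp add: mult_ac)
qed

text \<open>The value that the derivative of the error takes at almost every time.\<close>

definition err_deriv :: "(nat \<Rightarrow> nat) \<Rightarrow> real \<Rightarrow> real^'n" where
  "err_deriv \<xi> s = rand \<xi> s *v err \<xi> s + (rand \<xi> s - A) *v x s"

text \<open>Resampling the index \<open>k\<close> leaves the error at the left end of the cell unchanged and averages the
  deviation matrix to zero.\<close>

lemma expect_grid_err_uncorrelated:
  assumes k: "k \<in> {1..K}"
  shows "E (\<lambda>\<xi>. err \<xi> (\<tau> (k - 1)) \<bullet> ((sampled (\<xi> k) - A) *v y)) = 0"
proof -
  let ?a = "\<tau> (k - 1)"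
  have "E (\<lambda>\<xi>. err \<xi> ?a \<bullet> ((sampled (\<xi> k) - A) *v y))
      = E (\<lambda>\<xi>. \<Sum>v\<in>Omega M. p v * (err (\<xi>(k := v)) ?a \<bullet> ((sampled v - A) *v y)))"
    by (subst expect_resample[OF p_sum k]) simp
  also have "\<dots> = E (\<lambda>\<xi>. 0)"
  proof (rule expect_cong)
    fix \<xi> assume \<xi>: "\<xi> \<in> Omega_paths M K"
    have "(\<Sum>v\<in>Omega M. p v * (err (\<xi>(k := v)) ?a \<bullet> ((sampled v - A) *v y)))
        = err \<xi> ?a \<bullet> (\<Sum>v\<in>Omega M. p v *\<^sub>R ((sampled v - A) *v y))"
      unfolding inner_sum_right inner_scaleR_right
      by (intro sum.cong refl) (simp only: err_independent[OF \<xi> k])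
    then show "(\<Sum>v\<in>Omega M. p v * (err (\<xi>(k := v)) ?a \<bullet> ((sampled v - A) *v y))) = 0"
      by (simp add: mean_deviation)
  qed
  finally show ?thesis by (simp add: expect_def)
qed

text \<open>The key estimate. The error is split into its value at the left end of the cell, which does not
  contribute on average, and the increment since then, which is of order \<open>h\<close>. The second factor
  \<open>dev (\<xi> k)\<close> that turns the increment bound into a second moment comes from the matrix \<open>?D\<close>.\<close>

lemma expect_energy_rate:
  assumes t: "t \<in> {0..<T}"
  shows "E (\<lambda>\<xi>. err \<xi> t \<bullet> err_deriv \<xi> t) \<le> h * V * R\<^sup>2 * (1 + op_norm A * t)"
proof -
  obtain k where k: "k \<in> {1..K}" and cell: "t \<in> {\<tau> (k - 1)..<\<tau> k}"
    using t by (rule obtain_cell)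
  have tT: "t \<in> {0..T}" using t by auto
  let ?a = "\<tau> (k - 1)" and ?I = "\<lambda>\<xi>. integral {0..t} (path_dev \<xi>)"
  let ?D = "\<lambda>\<xi>. (sampled (\<xi> k) - A) *v x t"
  have "0 < h" using grid_spacing[OF k] grid_step[OF k] by linarith
  have pointwise: "err \<xi> t \<bullet> err_deriv \<xi> t
      \<le> err \<xi> ?a \<bullet> ?D \<xi> + h * R\<^sup>2 * (op_norm A * (dev (\<xi> k) * ?I \<xi>) + (dev (\<xi> k))\<^sup>2)"
    if \<xi>: "\<xi> \<in> Omega_paths M K" for \<xi>
  proof -
    have "err \<xi> t \<bullet> err_deriv \<xi> t \<le> err \<xi> t \<bullet> ?D \<xi>"
      using dissipative_rand[OF \<xi> t] unfolding dissipative_def err_deriv_def inner_add_right rand_cell[OF k cell]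
      by simp
    also have "\<dots> = err \<xi> ?a \<bullet> ?D \<xi> + (err \<xi> t - err \<xi> ?a) \<bullet> ?D \<xi>"
      by (simp add: inner_diff_left)
    also have "(err \<xi> t - err \<xi> ?a) \<bullet> ?D \<xi> \<le> norm (err \<xi> t - err \<xi> ?a) * norm (?D \<xi>)"
      by (rule norm_cauchy_schwarz)
    also have "\<dots> \<le> (h * R * (op_norm A * ?I \<xi> + dev (\<xi> k))) * (dev (\<xi> k) * R)"
    proof (rule mult_mono)
      show "norm (err \<xi> t - err \<xi> ?a) \<le> h * R * (op_norm A * ?I \<xi> + dev (\<xi> k))"
        using \<xi> k cell by (rule err_increment)
      then show "0 \<le> h * R * (op_norm A * ?I \<xi> + dev (\<xi> k))"
        using norm_ge_zero order_trans by blast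
      show "norm (?D \<xi>) \<le> dev (\<xi> k) * R"
        unfolding dev_def
        by (rule order_trans[OF norm_mult_vec_le mult_left_mono[OF x_bound[OF tT] op_norm_nonneg]])
    qed simp
    also have "\<dots> = h * R\<^sup>2 * (op_norm A * (dev (\<xi> k) * ?I \<xi>) + (dev (\<xi> k))\<^sup>2)"
      by (simp add: power2_eq_square algebra_simps)
    finally show ?thesis by simp
  qed
  have "E (\<lambda>\<xi>. err \<xi> t \<bullet> err_deriv \<xi> t)
      \<le> E (\<lambda>\<xi>. err \<xi> ?a \<bullet> ?D \<xi> + h * R\<^sup>2 * (op_norm A * (dev (\<xi> k) * ?I \<xi>) + (dev (\<xi> k))\<^sup>2))"
    by (intro expect_mono p_nonneg pointwise)
  also have "\<dots> = h * R\<^sup>2 * (op_norm A * E (\<lambda>\<xi>. dev (\<xi> k) * ?I \<xi>) + V)"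
    by (simp only: expect_add expect_cmult expect_grid_err_uncorrelated[OF k] expect_dev_square[OF k] add_0_left)
  also have "\<dots> \<le> h * R\<^sup>2 * (op_norm A * (V * t) + V)"
    using \<open>0 < h\<close> by (intro mult_left_mono add_right_mono expect_dev_integral[OF k tT] op_norm_nonneg) simp
  finally show ?thesis by (simp add: algebra_simps)
qed

text \<open>The square of the norm is Lipschitz on bounded sets and the error is bounded by \<open>2 * R\<close>, so the squared
  norm of the error is again absolutely continuous.\<close>

lemma err_energy:
  assumes \<xi>: "\<xi> \<in> Omega_paths M K" and t: "t \<in> {0..T}"
  shows "((\<lambda>s. 2 * (err \<xi> s \<bullet> err_deriv \<xi> s)) has_integral (norm (err \<xi> t))\<^sup>2) {0..t}"
proof -
  let ?q = "\<lambda>s. err \<xi> s \<bullet> err \<xi> s"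
  obtain N where N: "negligible N" and deriv: "\<And>s. s \<in> {0..T} - N \<Longrightarrow>
      (err \<xi> has_vector_derivative err_deriv \<xi> s) (at s within {0..T})"
    using solves_ivp_derivative[OF err_equation[OF \<xi>]] unfolding err_deriv_def by metis
  have ac: "abs_continuous_on 0 T (err \<xi>)" and "err \<xi> 0 = 0"
    using err_equation[OF \<xi>] by (auto simp: solves_ivp_def)
  have sub: "{0..t} \<subseteq> {0..T}" using t by auto
  have "abs_continuous_on 0 T ?q"
  proof (rule abs_continuous_on_dominated[OF ac, of "4 * R"])
    show "0 \<le> 4 * R" using R_nonneg by simp
    fix r s assume rs: "r \<in> {0..T}" "s \<in> {0..T}"
    have "?q r - ?q s = (err \<xi> r + err \<xi> s) \<bullet> (err \<xi> r - err \<xi> s)"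
      by (simp add: algebra_simps inner_commute)
    then have "norm (?q r - ?q s) \<le> norm (err \<xi> r + err \<xi> s) * norm (err \<xi> r - err \<xi> s)"
      by (simp add: Cauchy_Schwarz_ineq2)
    also have "\<dots> \<le> (4 * R) * norm (err \<xi> r - err \<xi> s)"
      using norm_triangle_mono[OF err_bound[OF \<xi> rs(1)] err_bound[OF \<xi> rs(2)]]
      by (intro mult_right_mono) auto
    finally show "norm (?q r - ?q s) \<le> 4 * R * norm (err \<xi> r - err \<xi> s)" .
  qed
  then have "abs_continuous_on 0 t ?q"
    using sub by (rule abs_continuous_on_subinterval)
  then have "((\<lambda>s. 2 * (err \<xi> s \<bullet> err_deriv \<xi> s)) has_integral (?q t - ?q 0)) {0..t}"
  proof (rule fundamental_theorem_of_calculus_abs_continuous[rotated, OF _ N])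
    fix s assume "s \<in> {0..t} - N"
    then have "(err \<xi> has_vector_derivative err_deriv \<xi> s) (at s within {0..t})"
      using deriv[of s] sub by (auto intro: has_vector_derivative_within_subset)
    then have "(?q has_vector_derivative (err \<xi> s \<bullet> err_deriv \<xi> s + err_deriv \<xi> s \<bullet> err \<xi> s)) (at s within {0..t})"
      by (intro bounded_bilinear.has_vector_derivative[OF bounded_bilinear_inner])
    then show "(?q has_vector_derivative 2 * (err \<xi> s \<bullet> err_deriv \<xi> s)) (at s within {0..t})"
      by (simp add: inner_commute)
  qed (use t in auto)
  then show ?thesis
    using \<open>err \<xi> 0 = 0\<close> by (simp add: power2_norm_eq_inner)
qed

theorem mean_square_error:
  assumes t: "t \<in> {0..T}"
  shows "E (\<lambda>\<xi>. (norm (err \<xi> t))\<^sup>2) \<le> h * V * (op_norm A * t\<^sup>2 + 2 * t) * R\<^sup>2"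
proof (rule has_integral_le)
  let ?G = "\<lambda>s. 2 * (h * V * R\<^sup>2 * (1 + op_norm A * s))"
  have "((\<lambda>s. E (\<lambda>\<xi>. 2 * (err \<xi> s \<bullet> err_deriv \<xi> s))) has_integral E (\<lambda>\<xi>. (norm (err \<xi> t))\<^sup>2)) {0..t}"
    by (intro has_integral_expect err_energy t)
  \<comment> \<open>The final time lies in no cell, so the rate estimate says nothing there.\<close>
  then show "((\<lambda>s. if s = T then ?G T else E (\<lambda>\<xi>. 2 * (err \<xi> s \<bullet> err_deriv \<xi> s)))
      has_integral E (\<lambda>\<xi>. (norm (err \<xi> t))\<^sup>2)) {0..t}"
    by (rule has_integral_spike[of "{T}", rotated 2]) auto
  have "(?G has_integral (h * V * R\<^sup>2 * (2 * t + op_norm A * t\<^sup>2)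
      - h * V * R\<^sup>2 * (2 * 0 + op_norm A * 0\<^sup>2))) {0..t}"
    using t by (intro fundamental_theorem_of_calculus)
      (auto intro!: derivative_eq_intros simp: algebra_simps simp flip: has_real_derivative_iff_has_vector_derivative)
  then show "(?G has_integral h * V * (op_norm A * t\<^sup>2 + 2 * t) * R\<^sup>2) {0..t}"
    by (simp add: algebra_simps)
  fix s assume s: "s \<in> {0..t}"
  show "(if s = T then ?G T else E (\<lambda>\<xi>. 2 * (err \<xi> s \<bullet> err_deriv \<xi> s))) \<le> ?G s"
    using expect_energy_rate[of s] s t by (auto simp: expect_cmult)
qed

end

section \<open>The mean square error bound\<close>

theorem theorem1:
  fixes A :: "real^'n^'n" and B :: "real^'q^'n" and x0 :: "real^'n"
    and Am :: "nat \<Rightarrow> real^'n^'n" and M K :: nat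
    and S :: "nat \<Rightarrow> nat set" and p :: "nat \<Rightarrow> real"
    and T :: real and \<tau> :: "nat \<Rightarrow> real" and u :: "real \<Rightarrow> real^'q"
    and x :: "real \<Rightarrow> real^'n" and xh eh :: "(nat \<Rightarrow> nat) \<Rightarrow> real \<Rightarrow> real^'n"
  assumes "T > 0"
    and "A = (\<Sum>m=1..M. Am m)"
    and "enumerates_subsets M S"
    and "\<And>\<omega>. \<omega> \<in> Omega M \<Longrightarrow> p \<omega> \<ge> 0"
    and "is_grid T K \<tau>"
    and "\<And>m. m \<in> {1..M} \<Longrightarrow> dissipative (Am m)"
    and "(\<Sum>\<omega>\<in>Omega M. p \<omega>) = 1"
    and "\<And>m. m \<in> {1..M} \<Longrightarrow> sel_prob M S p m > 0"
    and "in_Lp 2 T u"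
    and "solves_ivp T (\<lambda>s y. A *v y + B *v u s) x0 x"
    and "\<And>\<omega>. \<omega> \<in> Omega_paths M K \<Longrightarrow>
           solves_ivp T (\<lambda>s y. random_matrix M S p Am K \<tau> \<omega> s *v y + B *v u s) x0 (xh \<omega>)"
    and "\<And>\<omega> t. \<omega> \<in> Omega_paths M K \<Longrightarrow> t \<in> {0..T} \<Longrightarrow> eh \<omega> t = xh \<omega> t - x t"
  shows "\<forall>t\<in>{0..T}. expect M p K (\<lambda>\<omega>. (norm (eh \<omega> t))\<^sup>2)
           \<le> max_spacing K \<tau> * Var_matrix M S p Am A * (op_norm A * t\<^sup>2 + 2 * t)
              * (norm x0 + Lp_norm 1 T (\<lambda>s. B *v u s))\<^sup>2"
proof
  fix t assume t: "t \<in> {0..T}"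
  interpret splitting_solutions A Am M K S p T \<tau> B u x0 x xh
    by unfold_locales (use assms in \<open>simp_all\<close>)
  have "expect M p K (\<lambda>\<omega>. (norm (eh \<omega> t))\<^sup>2) = E (\<lambda>\<omega>. (norm (err \<omega> t))\<^sup>2)"
    using t by (intro expect_cong) (simp add: assms(12) err_def)
  then show "expect M p K (\<lambda>\<omega>. (norm (eh \<omega> t))\<^sup>2)
      \<le> max_spacing K \<tau> * Var_matrix M S p Am A * (op_norm A * t\<^sup>2 + 2 * t)
         * (norm x0 + Lp_norm 1 T (\<lambda>s. B *v u s))\<^sup>2"
    using mean_square_error[OF t] by (simp add: R_def)
qed

end
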